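(* Let $\mathfrak g$ be a nonzero complete left-symmetric algebra over $\mathbb C$ whose canonical decomposition $\mathfrak g=\bigoplus_\lambda\mathfrak g^\lambda$ satisfies $\dim\mathfrak g^\lambda\le 1$ for all $\lambda$. Then the directed graph $\Gamma_l$ has no directed cycles other than loops; i.e. there is no closed directed path $\lambda_0\to\lambda_1\to\dots\to\lambda_m=\lambda_0$ in $\Gamma_l$ with $m\ge2$ and $\lambda_0,\dots,\lambda_{m-1}$ pairwise distinct.
   Context: All algebras are finite dimensional. A left-symmetric algebra is a vector space $\mathfrak g$ with a bilinear product such that $x(yz)-(xy)z=y(xz)-(yx)z$ for all $x,y,z$. Then $[x,y]=xy-yx$ is a Lie bracket and $L(x)y=xy$ defines a representation of the Lie algebra $\mathfrak g$. The fields $F_x(y)=xy+x$, $x\in\mathfrak g$, form a Lie algebra of affine vector fields on the space $\mathfrak g$; $\mathfrak g$ is complete if the group of affine transformations generated by their flows acts transitively on $\mathfrak g$. Canonical decomposition: a complete left-symmetric algebra over $\mathbb C$ has a unique Cartan subalgebra $\mathfrak h$ of the Lie algebra $\mathfrak g$ such that, for every linear functional $\lambda$ on $\mathfrak h$, the root subspace (generalized weight space) $\mathfrak g^\lambda$ of $\lambda$ for $L|_{\mathfrak h}$ equals the root subspace for $\operatorname{ad}|_{\mathfrak h}$; the canonical decomposition is $\mathfrak g=\bigoplus_\lambda\mathfrak g^\lambda$, and $\mathfrak g^0=\mathfrak h$. It satisfies $\mathfrak g^\lambda\mathfrak g^\mu\subseteq\mathfrak g^{\lambda+\mu}$. Graphs: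 assume $\dim\mathfrak g^\lambda\le1$ for all $\lambda$. Fix $e_0\in\mathfrak g^0$, $e_0\neq0$. Identify each functional $\lambda$ with $\mathfrak g^\lambda\ne0$ with the number $\lambda(e_0)$; the set of these numbers is $\Lambda\subset\mathbb C$, the spectrum of $L(e_0)$ (it contains $0$). For each $\lambda\in\Lambda$ choose an eigenvector $e_\lambda\in\mathfrak g^\lambda$, $e_0e_\lambda=\lambda e_\lambda$ (with the chosen $e_0$ for $\lambda=0$). In the base $\{e_\lambda\}_{\lambda\in\Lambda}$ the product is $e_\lambda e_\mu=c_{\lambda,\mu}e_{\lambda+\mu}$, with the convention $e_\lambda=0$ and $c_{\lambda,\mu}=c_{\mu,\lambda}=0$ if $\lambda\notin\Lambda$. $\Gamma_l$ is the directed graph (loops allowed) with vertex set $\Lambda$ having an edge from $\lambda$ to $\mu$ if and only if $c_{\mu-\lambda,\lambda}\neq0$. *)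

theory Defs
  imports Complex_Main
begin

locale left_symmetric_algebra = vector_space scale
  for scale :: "complex \<Rightarrow> 'a::ab_group_add \<Rightarrow> 'a" +
  fixes mul :: "'a \<Rightarrow> 'a \<Rightarrow> 'a"
  assumes finite_dimensional: "\<exists>B. finite B \<and> span B = UNIV"
    and mul_add_left: "mul (x + y) z = mul x z + mul y z"
    and mul_add_right: "mul x (y + z) = mul x y + mul x z"
    and mul_scale_left: "mul (scale a x) y = scale a (mul x y)"
    and mul_scale_right: "mul x (scale a y) = scale a (mul x y)"
    and left_symmetric: "mul x (mul y z) - mul (mul x y) z = mul y (mul x z) - mul (mul y x) z"
begin

definition bracket :: "'a \<Rightarrow> 'a \<Rightarrow> 'a" where
  "bracket x y = mul x y - mul y x"

definition affine_field :: "'a \<Rightarrow> 'a \<Rightarrow> 'a" where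
  "affine_field x y = mul x y + x"

text \<open>The type \<open>'a\<close> carries no topology. Differentiability of a curve in a finite-dimensional
  space (for its unique Hausdorff vector space topology) is tested on all linear functionals,
  that is, on coordinates.\<close>

definition has_curve_derivative :: "(real \<Rightarrow> 'a) \<Rightarrow> 'a \<Rightarrow> real \<Rightarrow> bool" where
  "has_curve_derivative u v t \<longleftrightarrow>
     (\<forall>f :: 'a \<Rightarrow> complex. Vector_Spaces.linear scale (*) f \<longrightarrow>
        ((\<lambda>s. f (u s)) has_vector_derivative f v) (at t))"

definition is_flow :: "'a \<Rightarrow> (real \<Rightarrow> 'a \<Rightarrow> 'a) \<Rightarrow> bool" where
  "is_flow x \<Phi> \<longleftrightarrow>
     (\<forall>y. \<Phi> 0 y = y \<and>
        (\<forall>t. has_curve_derivative (\<lambda>s. \<Phi> s y) (affine_field x (\<Phi> t y)) t))"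

text \<open>Every element of the group below is in fact bijective; the premise \<open>bij g\<close> only guards
  the use of \<open>inv\<close>. Complex times are covered by real ones, since \<open>x\<close> ranges over a complex
  space and \<open>affine_field\<close> is complex linear in \<open>x\<close>.\<close>

inductive_set flow_group :: "('a \<Rightarrow> 'a) set" where
  flow_group_id: "id \<in> flow_group"
| flow_group_flow: "is_flow x \<Phi> \<Longrightarrow> \<Phi> t \<in> flow_group"
| flow_group_comp: "g \<in> flow_group \<Longrightarrow> k \<in> flow_group \<Longrightarrow> g \<circ> k \<in> flow_group"
| flow_group_inv: "g \<in> flow_group \<Longrightarrow> bij g \<Longrightarrow> inv g \<in> flow_group"

definition complete_lsa :: bool where
  "complete_lsa \<longleftrightarrow> (\<forall>y z. \<exists>g\<in>flow_group. g y = z)"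

definition lie_subalgebra :: "'a set \<Rightarrow> bool" where
  "lie_subalgebra h \<longleftrightarrow> subspace h \<and> (\<forall>x\<in>h. \<forall>y\<in>h. bracket x y \<in> h)"

primrec lower_central :: "'a set \<Rightarrow> nat \<Rightarrow> 'a set" where
  "lower_central h 0 = h"
| "lower_central h (Suc n) = span {bracket x y |x y. x \<in> h \<and> y \<in> lower_central h n}"

definition lie_nilpotent :: "'a set \<Rightarrow> bool" where
  "lie_nilpotent h \<longleftrightarrow> (\<exists>n. lower_central h n = {0})"

definition lie_normalizer :: "'a set \<Rightarrow> 'a set" where
  "lie_normalizer h = {x. \<forall>y\<in>h. bracket x y \<in> h}"

definition cartan_subalgebra :: "'a set \<Rightarrow> bool" where
  "cartan_subalgebra h \<longleftrightarrow> lie_subalgebra h \<and> lie_nilpotent h \<and> lie_normalizer h = h"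

text \<open>A linear functional on \<open>h\<close> is represented by a total function whose values outside \<open>h\<close>
  are irrelevant: below, functionals on \<open>h\<close> are only evaluated at points of \<open>h\<close>.\<close>

definition functional_on :: "'a set \<Rightarrow> ('a \<Rightarrow> complex) \<Rightarrow> bool" where
  "functional_on h \<theta> \<longleftrightarrow>
     (\<forall>x\<in>h. \<forall>y\<in>h. \<theta> (x + y) = \<theta> x + \<theta> y) \<and> (\<forall>a. \<forall>x\<in>h. \<theta> (scale a x) = a * \<theta> x)"

definition root_subspace :: "('a \<Rightarrow> 'a \<Rightarrow> 'a) \<Rightarrow> 'a set \<Rightarrow> ('a \<Rightarrow> complex) \<Rightarrow> 'a set" where
  "root_subspace \<rho> h \<theta> = {y. \<forall>x\<in>h. \<exists>n. ((\<lambda>z. \<rho> x z - scale (\<theta> x) z) ^^ n) y = 0}"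

text \<open>\<open>mul\<close> and \<open>bracket\<close>, read as maps \<open>x \<mapsto> \<rho> x\<close>, are the representations \<open>L\<close> and \<open>ad\<close>.\<close>

definition canonical_cartan :: "'a set \<Rightarrow> bool" where
  "canonical_cartan h \<longleftrightarrow> cartan_subalgebra h \<and>
     (\<forall>\<theta>. functional_on h \<theta> \<longrightarrow> root_subspace mul h \<theta> = root_subspace bracket h \<theta>)"

abbreviation component :: "'a set \<Rightarrow> ('a \<Rightarrow> complex) \<Rightarrow> 'a set" where
  "component h \<theta> \<equiv> root_subspace mul h \<theta>"

definition root_values :: "'a set \<Rightarrow> 'a \<Rightarrow> complex set" where
  "root_values h e\<^sub>0 = {\<theta> e\<^sub>0 |\<theta>. functional_on h \<theta> \<and> component h \<theta> \<noteq> {0}}"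

definition root_basis :: "'a set \<Rightarrow> 'a \<Rightarrow> (complex \<Rightarrow> 'a) \<Rightarrow> bool" where
  "root_basis h e\<^sub>0 e \<longleftrightarrow>
     e 0 = e\<^sub>0 \<and>
     (\<forall>\<theta>. functional_on h \<theta> \<and> component h \<theta> \<noteq> {0} \<longrightarrow>
        e (\<theta> e\<^sub>0) \<in> component h \<theta> \<and> e (\<theta> e\<^sub>0) \<noteq> 0 \<and>
        mul e\<^sub>0 (e (\<theta> e\<^sub>0)) = scale (\<theta> e\<^sub>0) (e (\<theta> e\<^sub>0))) \<and>
     (\<forall>\<alpha>. \<alpha> \<notin> root_values h e\<^sub>0 \<longrightarrow> e \<alpha> = 0)"

text \<open>If \<open>\<alpha>\<close> and \<open>\<beta>\<close> are root values but \<open>\<alpha> + \<beta>\<close> is not, then \<open>c \<alpha> \<beta>\<close> is left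
  unconstrained; the graph below does not depend on such values.\<close>

definition structure_constants ::
  "'a set \<Rightarrow> 'a \<Rightarrow> (complex \<Rightarrow> 'a) \<Rightarrow> (complex \<Rightarrow> complex \<Rightarrow> complex) \<Rightarrow> bool" where
  "structure_constants h e\<^sub>0 e c \<longleftrightarrow>
     (\<forall>\<alpha> \<beta>. mul (e \<alpha>) (e \<beta>) = scale (c \<alpha> \<beta>) (e (\<alpha> + \<beta>))) \<and>
     (\<forall>\<alpha> \<beta>. \<alpha> \<notin> root_values h e\<^sub>0 \<longrightarrow> c \<alpha> \<beta> = 0 \<and> c \<beta> \<alpha> = 0)"

definition left_graph ::
  "'a set \<Rightarrow> 'a \<Rightarrow> (complex \<Rightarrow> complex \<Rightarrow> complex) \<Rightarrow> (complex \<times> complex) set" where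
  "left_graph h e\<^sub>0 c =
     {(\<alpha>, \<beta>). \<alpha> \<in> root_values h e\<^sub>0 \<and> \<beta> \<in> root_values h e\<^sub>0 \<and> c (\<beta> - \<alpha>) \<alpha> \<noteq> 0}"

end

end

theory Submission
  imports Defs
begin

text \<open>The null component contains the nonzero Cartan subalgebra and is at most one-dimensional, so
  it is the Cartan subalgebra, spanned by \<open>e\<^sub>0\<close>. Since \<open>L\<close> and \<open>ad\<close> have the same roots, the
  difference of \<open>L(e\<^sub>0)\<close> and \<open>ad(e\<^sub>0)\<close>, which is right multiplication by \<open>e\<^sub>0\<close>, vanishes. Hence
  \<open>e\<^sub>0\<close> is invariant under all left multiplications. If \<open>[e\<^sub>\<alpha>, e\<^sub>-\<^sub>\<alpha>] \<noteq> 0\<close> for a nonzero root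
  \<open>\<alpha>\<close>, then \<open>e\<^sub>\<alpha>\<close>, \<open>e\<^sub>0\<close>, \<open>e\<^sub>-\<^sub>\<alpha>\<close> span a copy of \<open>sl\<^sub>2\<close>, and the representation theory of
  \<open>sl\<^sub>2\<close> forbids that the one-dimensional zero weight space be invariant while \<open>\<alpha>\<close>
  is a weight: the \<open>\<alpha>\<close>-string would not end (\<open>bracket_const_opposite\<close>).

  So the \<open>e\<^sub>\<alpha>\<close> with \<open>\<alpha> \<noteq> 0\<close> span a Lie subalgebra. Its homogeneous elements act nilpotently through
  \<open>L\<close> because they shift a finite set of roots, and Engel's theorem (\<open>graded_engel\<close>) makes
  these left multiplications strictly triangular with respect to an ordering of the \<open>e\<^sub>\<alpha>\<close>. The edges
  of the graph other than loops are exactly the nonzero matrix entries of these operators,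
  so they go in one direction of that ordering. The proof applies Engel's theorem to the subquotient
  of \<open>L\<close> carried by a strongly connected component (\<open>acyclic_nonloop_edges\<close>).\<close>

section \<open>Engel's theorem for graded operators with one-dimensional weight spaces\<close>

text \<open>Translation by \<open>w\<close> would permute \<open>K\<close>, so summing over \<open>K\<close> gives \<open>card K\<close> times \<open>w\<close> equal
  to zero.\<close>

lemma finite_translate_subset_empty:
  fixes w :: "'w::real_vector"
  assumes "finite K" and "w \<noteq> 0" and closed: "\<And>x. x \<in> K \<Longrightarrow> w + x \<in> K"
  shows "K = {}"
proof -
  have "(+) w ` K = K"
    using \<open>finite K\<close> closed by (intro card_subset_eq) (auto simp: card_image)
  then have "(\<Sum>x\<in>K. x) = (\<Sum>x\<in>K. w + x)"
    by (metis (no_types, lifting) add_left_cancel inj_onI sum.reindex_cong)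
  then have "of_nat (card K) *\<^sub>R w = 0"
    by (simp add: sum.distrib sum_constant_scaleR)
  with assms show ?thesis by auto
qed

text \<open>This is Engel's theorem for a Lie algebra with basis \<open>(x\<^sub>\<sigma>)\<^sub>\<sigma>\<^sub>\<in>\<^sub>S\<close> and brackets
  \<open>[x\<^sub>\<sigma>, x\<^sub>\<tau>] = b \<sigma> \<tau> x\<^sub>\<sigma>\<^sub>+\<^sub>\<tau>\<close>, acting on a space with basis \<open>(v\<^sub>\<nu>)\<^sub>\<nu>\<^sub>\<in>\<^sub>A\<close> by
  \<open>x\<^sub>\<sigma> v\<^sub>\<nu> = a \<sigma> \<nu> v\<^sub>\<sigma>\<^sub>+\<^sub>\<nu>\<close>. Every \<open>x\<^sub>\<sigma>\<close> is nilpotent because it shifts the finitely many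
  weights by \<open>\<sigma> \<noteq> 0\<close>. A common kernel of homogeneous operators is spanned by basis vectors, so
  subalgebras, quotients and kernels in Engel's induction may all be replaced by sets of
  weights.\<close>

lemma graded_engel:
  fixes b :: "'w::real_vector \<Rightarrow> 'w \<Rightarrow> 'k::idom" and a :: "'w \<Rightarrow> 'w \<Rightarrow> 'k"
  assumes "finite S" and "0 \<notin> S" and "finite A" and "A \<noteq> {}"
    and alternating: "\<And>\<sigma>. b \<sigma> \<sigma> = 0"
    and antisymmetric: "\<And>\<sigma> \<tau>. b \<tau> \<sigma> = - b \<sigma> \<tau>"
    and jacobi: "\<And>\<sigma> \<tau> \<nu>.
      b \<sigma> (\<tau> + \<nu>) * b \<tau> \<nu> - b \<tau> (\<sigma> + \<nu>) * b \<sigma> \<nu> = b \<sigma> \<tau> * b (\<sigma> + \<tau>) \<nu>"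
    and "\<And>\<sigma> \<tau>. \<sigma> \<in> S \<Longrightarrow> \<tau> \<in> S \<Longrightarrow> b \<sigma> \<tau> \<noteq> 0 \<Longrightarrow> \<sigma> + \<tau> \<in> S"
    and "\<And>\<sigma> \<nu>. \<sigma> \<in> S \<Longrightarrow> \<nu> \<in> A \<Longrightarrow> a \<sigma> \<nu> \<noteq> 0 \<Longrightarrow> \<sigma> + \<nu> \<in> A"
    and "\<And>\<sigma> \<tau> \<nu>. \<sigma> \<in> S \<Longrightarrow> \<tau> \<in> S \<Longrightarrow> \<nu> \<in> A \<Longrightarrow>
      a \<sigma> (\<tau> + \<nu>) * a \<tau> \<nu> - a \<tau> (\<sigma> + \<nu>) * a \<sigma> \<nu> = b \<sigma> \<tau> * a (\<sigma> + \<tau>) \<nu>"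
  shows "\<exists>\<nu>\<in>A. \<forall>\<sigma>\<in>S. a \<sigma> \<nu> = 0"
  using assms(1-4,8-)
proof (induction "card S" arbitrary: S A a rule: less_induct)
  case less
  note S = less.prems(1,2) and A = less.prems(3,4) and S_closed = less.prems(5)
    and A_closed = less.prems(6) and rep = less.prems(7)
  show ?case
  proof (cases "S = {}")
    case True
    with A show ?thesis by auto
  next
    case False
    define subalg where
      "subalg U \<longleftrightarrow> U \<subseteq> S \<and> (\<forall>\<sigma>\<in>U. \<forall>\<tau>\<in>U. b \<sigma> \<tau> \<noteq> 0 \<longrightarrow> \<sigma> + \<tau> \<in> U)" for U
    have "finite {U. subalg U \<and> U \<noteq> S}"
      by (rule finite_subset[of _ "Pow S"]) (use S in \<open>auto simp: subalg_def\<close>)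
    moreover have "{} \<in> {U. subalg U \<and> U \<noteq> S}"
      using False by (auto simp: subalg_def)
    ultimately obtain U where U: "subalg U" "U \<noteq> S"
      and maximal: "\<And>T. subalg T \<Longrightarrow> T \<noteq> S \<Longrightarrow> U \<subseteq> T \<Longrightarrow> T = U"
      using finite_has_maximal[of "{U. subalg U \<and> U \<noteq> S}"] by blast
    have US: "U \<subset> S" and U_closed: "\<And>\<sigma> \<tau>. \<sigma> \<in> U \<Longrightarrow> \<tau> \<in> U \<Longrightarrow> b \<sigma> \<tau> \<noteq> 0 \<Longrightarrow> \<sigma> + \<tau> \<in> U"
      using U unfolding subalg_def by auto
    have smaller: "card U < card S" and U_fin: "finite U" "0 \<notin> U"
      using US S by (auto intro: psubset_card_mono finite_subset)
    \<comment> \<open>The adjoint action of \<open>U\<close> on the quotient of \<open>S\<close> by \<open>U\<close> has a common kernel weight.\<close>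
    define q where "q \<sigma> \<nu> = (if \<nu> \<in> S - U \<and> \<sigma> + \<nu> \<in> S - U then b \<sigma> \<nu> else 0)" for \<sigma> \<nu>
    have q_rep: "q \<sigma> (\<tau> + \<nu>) * q \<tau> \<nu> - q \<tau> (\<sigma> + \<nu>) * q \<sigma> \<nu> = b \<sigma> \<tau> * q (\<sigma> + \<tau>) \<nu>"
      if \<sigma>: "\<sigma> \<in> U" and \<tau>: "\<tau> \<in> U" and \<nu>: "\<nu> \<in> S - U" for \<sigma> \<tau> \<nu>
    proof (cases "\<sigma> + (\<tau> + \<nu>) \<in> S - U")
      case True
      have mid: "q \<alpha> (\<beta> + \<nu>) * q \<beta> \<nu> = b \<alpha> (\<beta> + \<nu>) * b \<beta> \<nu>"
        if "\<alpha> \<in> U" "\<beta> \<in> U" "\<alpha> + (\<beta> + \<nu>) \<in> S - U" for \<alpha> \<beta>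
      proof (cases "\<beta> + \<nu> \<in> S - U")
        case True
        with that \<nu> show ?thesis by (simp add: q_def)
      next
        case False
        then have "b \<beta> \<nu> = 0 \<or> \<beta> + \<nu> \<in> U"
          using S_closed[of \<beta> \<nu>] that \<nu> US by auto
        then have "b \<alpha> (\<beta> + \<nu>) * b \<beta> \<nu> = 0"
          using U_closed[of \<alpha> "\<beta> + \<nu>"] that by auto
        with False show ?thesis by (auto simp: q_def)
      qed
      from True have True': "\<tau> + (\<sigma> + \<nu>) \<in> S - U" "\<sigma> + \<tau> + \<nu> \<in> S - U"
        by (simp_all add: ac_simps)
      have "q (\<sigma> + \<tau>) \<nu> = b (\<sigma> + \<tau>) \<nu>"
        using True' \<nu> by (simp add: q_def)
      with mid[OF \<sigma> \<tau> True] mid[OF \<tau> \<sigma> True'(1)] jacobi[of \<sigma> \<tau> \<nu>] show ?thesis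
        by simp
    next
      case False
      then have "\<tau> + (\<sigma> + \<nu>) \<notin> S - U" "\<sigma> + \<tau> + \<nu> \<notin> S - U"
        by (simp_all add: ac_simps)
      with False show ?thesis by (auto simp: q_def)
    qed
    have "\<exists>\<nu>\<in>S - U. \<forall>\<sigma>\<in>U. q \<sigma> \<nu> = 0"
    proof (rule less.hyps[OF smaller U_fin])
      show "finite (S - U)" "S - U \<noteq> {}" using S US by auto
      show "\<sigma> + \<nu> \<in> S - U" if "q \<sigma> \<nu> \<noteq> 0" for \<sigma> \<nu>
        using that by (auto simp: q_def split: if_splits)
    qed (use U_closed q_rep in auto)
    then obtain \<rho> where \<rho>: "\<rho> \<in> S" "\<rho> \<notin> U" and q\<rho>: "\<And>\<sigma>. \<sigma> \<in> U \<Longrightarrow> q \<sigma> \<rho> = 0"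
      by auto
    have \<rho>U: "b \<sigma> \<rho> = 0 \<or> \<sigma> + \<rho> \<in> U" if "\<sigma> \<in> U" for \<sigma>
      using q\<rho>[OF that] S_closed[of \<sigma> \<rho>] that \<rho> US by (auto simp: q_def split: if_splits)
    have "subalg (insert \<rho> U)"
      unfolding subalg_def
    proof (intro conjI ballI impI)
      fix \<sigma> \<tau> assume "\<sigma> \<in> insert \<rho> U" "\<tau> \<in> insert \<rho> U" "b \<sigma> \<tau> \<noteq> 0"
      then show "\<sigma> + \<tau> \<in> insert \<rho> U"
        using U_closed[of \<sigma> \<tau>] \<rho>U[of \<sigma>] \<rho>U[of \<tau>] alternating antisymmetric[of \<tau> \<rho>]
        by (auto simp: add.commute)
    qed (use \<rho> US in auto)
    then have S_eq: "S = insert \<rho> U"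
      using maximal[of "insert \<rho> U"] \<rho> by auto
    \<comment> \<open>\<open>U\<close> is an ideal of codimension one in \<open>S\<close>, so its common kernel is invariant under \<open>x\<^sub>\<rho>\<close>.\<close>
    define K where "K = {\<nu>\<in>A. \<forall>\<sigma>\<in>U. a \<sigma> \<nu> = 0}"
    have "\<exists>\<nu>\<in>A. \<forall>\<sigma>\<in>U. a \<sigma> \<nu> = 0"
      by (rule less.hyps[OF smaller U_fin A]) (use U_closed A_closed rep US in blast)+
    then have K: "finite K" "K \<noteq> {}"
      using A by (auto simp: K_def)
    have "\<rho> + \<nu> \<in> K" if \<nu>: "\<nu> \<in> K" and nz: "a \<rho> \<nu> \<noteq> 0" for \<nu>
    proof -
      have "a \<sigma> (\<rho> + \<nu>) = 0" if \<sigma>: "\<sigma> \<in> U" for \<sigma>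
      proof -
        have "a \<sigma> (\<rho> + \<nu>) * a \<rho> \<nu> = b \<sigma> \<rho> * a (\<sigma> + \<rho>) \<nu>"
          using rep[of \<sigma> \<rho> \<nu>] \<sigma> \<nu> \<rho> US by (auto simp: K_def)
        also have "\<dots> = 0"
          using \<rho>U[OF \<sigma>] \<nu> by (auto simp: K_def)
        finally show ?thesis using nz by simp
      qed
      with A_closed[of \<rho> \<nu>] \<nu> nz \<rho> show ?thesis by (auto simp: K_def)
    qed
    moreover have "\<rho> \<noteq> 0" using \<rho> S by auto
    ultimately obtain \<nu> where "\<nu> \<in> K" "a \<rho> \<nu> = 0"
      using finite_translate_subset_empty[of K \<rho>] K by metis
    then show ?thesis by (auto simp: K_def S_eq)
  qed
qed

section \<open>Multiplication tables graded by complex weights\<close>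

text \<open>The structure constants of a left-symmetric algebra with basis
  \<open>(e\<^sub>\<alpha>)\<^sub>\<alpha>\<^sub>\<in>\<^sub>\<Lambda>\<close> and product \<open>e\<^sub>\<alpha> e\<^sub>\<beta> = d \<alpha> \<beta> e\<^sub>\<alpha>\<^sub>+\<^sub>\<beta>\<close>, set to zero where an index leaves
  \<open>\<Lambda>\<close>. The equality of the roots of \<open>L\<close> and \<open>ad\<close> enters as \<open>e\<^sub>\<alpha> e\<^sub>0 = 0\<close>.\<close>

locale root_table =
  fixes \<Lambda> :: "complex set" and d :: "complex \<Rightarrow> complex \<Rightarrow> complex"
  assumes finite_roots: "finite \<Lambda>"
    and support: "d \<alpha> \<beta> \<noteq> 0 \<Longrightarrow> \<alpha> \<in> \<Lambda> \<and> \<beta> \<in> \<Lambda> \<and> \<alpha> + \<beta> \<in> \<Lambda>"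
    and left_zero: "\<alpha> \<in> \<Lambda> \<Longrightarrow> d 0 \<alpha> = \<alpha>"
    and right_zero: "d \<alpha> 0 = 0"
    and left_rep: "d \<alpha> (\<beta> + \<gamma>) * d \<beta> \<gamma> - d \<beta> (\<alpha> + \<gamma>) * d \<alpha> \<gamma>
      = (d \<alpha> \<beta> - d \<beta> \<alpha>) * d (\<alpha> + \<beta>) \<gamma>"
begin

definition bracket_const :: "complex \<Rightarrow> complex \<Rightarrow> complex" where
  "bracket_const \<alpha> \<beta> = d \<alpha> \<beta> - d \<beta> \<alpha>"

lemma bracket_const_jacobi:
  "bracket_const \<alpha> (\<beta> + \<gamma>) * bracket_const \<beta> \<gamma> - bracket_const \<beta> (\<alpha> + \<gamma>) * bracket_const \<alpha> \<gamma>
    = bracket_const \<alpha> \<beta> * bracket_const (\<alpha> + \<beta>) \<gamma>"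
  using left_rep[of \<alpha> \<beta> \<gamma>] left_rep[of \<beta> \<gamma> \<alpha>] left_rep[of \<alpha> \<gamma> \<beta>]
  by (simp add: bracket_const_def algebra_simps)

text \<open>If the bracket of \<open>e\<^sub>\<alpha>\<close> and \<open>e\<^sub>-\<^sub>\<alpha>\<close> were a nonzero multiple of \<open>e\<^sub>0\<close>, these three vectors would
  span a copy of \<open>sl\<^sub>2\<close>. In its module spanned by the \<open>e\<^sub>j\<^sub>\<alpha>\<close>, the vector \<open>e\<^sub>0\<close> is invariant, and
  comparing the two sides of \<open>[L(e\<^sub>\<alpha>), L(e\<^sub>-\<^sub>\<alpha>)] = L([e\<^sub>\<alpha>, e\<^sub>-\<^sub>\<alpha>])\<close> along the string shows that
  \<open>L(e\<^sub>\<alpha>)\<close> never vanishes on \<open>e\<^sub>j\<^sub>\<alpha>\<close> for \<open>j \<ge> 1\<close>; the string would be infinite.\<close>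

lemma bracket_const_opposite:
  assumes "\<alpha> \<noteq> 0"
  shows "bracket_const \<alpha> (- \<alpha>) = 0"
proof (rule ccontr)
  define k where "k = bracket_const \<alpha> (- \<alpha>)"
  assume "bracket_const \<alpha> (- \<alpha>) \<noteq> 0"
  then have k: "k \<noteq> 0" by (simp add: k_def)
  then have \<alpha>: "\<alpha> \<in> \<Lambda>"
    using support[of \<alpha> "- \<alpha>"] support[of "- \<alpha>" \<alpha>]
    by (cases "d \<alpha> (- \<alpha>) = 0") (auto simp: k_def bracket_const_def)
  define p where "p j = d \<alpha> (of_nat j * \<alpha>) * d (- \<alpha>) (of_nat (Suc j) * \<alpha>)" for j
  have string: "of_nat (Suc j) * \<alpha> \<in> \<Lambda> \<and> 2 * p j = - (k * \<alpha> * of_nat j * of_nat (Suc j))" for j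
  proof (induction j)
    case 0
    show ?case using \<alpha> right_zero by (simp add: p_def)
  next
    case (Suc j)
    have "p j - p (Suc j) = k * d 0 (of_nat (Suc j) * \<alpha>)"
      using left_rep[of \<alpha> "- \<alpha>" "of_nat (Suc j) * \<alpha>"]
      by (simp add: p_def k_def bracket_const_def algebra_simps)
    also have "\<dots> = k * (of_nat (Suc j) * \<alpha>)"
      using Suc.IH left_zero by simp
    finally have "p (Suc j) = p j - k * (of_nat (Suc j) * \<alpha>)"
      by (simp add: algebra_simps)
    then have "2 * p (Suc j) = 2 * p j - 2 * (k * (of_nat (Suc j) * \<alpha>))"
      by (simp only: right_diff_distrib)
    also have "2 * p j = - (k * \<alpha> * of_nat j * of_nat (Suc j))"
      using Suc.IH by blast
    finally have eq: "2 * p (Suc j) = - (k * \<alpha> * of_nat (Suc j) * of_nat (Suc (Suc j)))"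
      by (simp add: algebra_simps)
    moreover have "- (k * \<alpha> * of_nat (Suc j) * of_nat (Suc (Suc j))) \<noteq> 0"
      using k assms of_nat_neq_0 by (simp del: of_nat_Suc)
    ultimately have "p (Suc j) \<noteq> 0" by auto
    then have "\<alpha> + of_nat (Suc j) * \<alpha> \<in> \<Lambda>"
      using support[of \<alpha> "of_nat (Suc j) * \<alpha>"] by (auto simp: p_def)
    with eq show ?case by (simp add: algebra_simps)
  qed
  have "range (\<lambda>j. of_nat (Suc j) * \<alpha>) = {}"
  proof (rule finite_translate_subset_empty[OF _ assms])
    show "finite (range (\<lambda>j. of_nat (Suc j) * \<alpha>))"
      using string by (intro finite_subset[OF _ finite_roots]) auto
    fix x assume "x \<in> range (\<lambda>j. of_nat (Suc j) * \<alpha>)"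
    then obtain j where "x = of_nat (Suc j) * \<alpha>" by auto
    then have "\<alpha> + x = of_nat (Suc (Suc j)) * \<alpha>" by (simp add: algebra_simps)
    then show "\<alpha> + x \<in> range (\<lambda>j. of_nat (Suc j) * \<alpha>)" by blast
  qed
  then show False by simp
qed

definition nonloop_edges :: "(complex \<times> complex) set" where
  "nonloop_edges = {(\<alpha>, \<beta>). \<alpha> \<noteq> \<beta> \<and> d (\<beta> - \<alpha>) \<alpha> \<noteq> 0}"

text \<open>The weights of a strongly connected component are the basis of a subquotient of the
  module \<open>L\<close>, since a path between two vertices of the component stays in it. Engel's theorem
  for this subquotient yields a vertex without edges into the component.\<close>

lemma acyclic_nonloop_edges: "acyclic nonloop_edges"
proof (rule acyclicI, intro allI notI)
  let ?E = nonloop_edges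
  fix x assume cyc: "(x, x) \<in> ?E\<^sup>+"
  define A where "A = {\<alpha>. (x, \<alpha>) \<in> ?E\<^sup>* \<and> (\<alpha>, x) \<in> ?E\<^sup>*}"
  have convex: "\<beta> \<in> A" if "\<alpha> \<in> A" "\<gamma> \<in> A" "(\<alpha>, \<beta>) \<in> ?E" "(\<beta>, \<gamma>) \<in> ?E" for \<alpha> \<beta> \<gamma>
    using that unfolding A_def
    by (auto intro: rtrancl_into_rtrancl converse_rtrancl_into_rtrancl)
  have successor: "\<exists>\<beta>\<in>A. (\<alpha>, \<beta>) \<in> ?E" if "\<alpha> \<in> A" for \<alpha>
  proof -
    have "(\<alpha>, x) \<in> ?E\<^sup>+"
      using that cyc unfolding A_def by (auto intro: rtrancl_trancl_trancl)
    then obtain \<beta> where "(\<alpha>, \<beta>) \<in> ?E" "(\<beta>, x) \<in> ?E\<^sup>*"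
      by (meson tranclD)
    with that show ?thesis
      unfolding A_def by (auto intro: rtrancl_into_rtrancl)
  qed
  have edge: "(\<nu>, \<sigma> + \<nu>) \<in> ?E" if "\<sigma> \<in> \<Lambda> - {0}" "d \<sigma> \<nu> \<noteq> 0" for \<sigma> \<nu>
    using that by (simp add: nonloop_edges_def)
  define a where "a \<sigma> \<nu> = (if \<nu> \<in> A \<and> \<sigma> + \<nu> \<in> A then d \<sigma> \<nu> else 0)" for \<sigma> \<nu>
  have "\<exists>\<nu>\<in>A. \<forall>\<sigma>\<in>\<Lambda> - {0}. a \<sigma> \<nu> = 0"
  proof (rule graded_engel[where b = bracket_const])
    have "A \<subseteq> \<Lambda>"
      using successor support by (fastforce simp: nonloop_edges_def)
    then show "finite A" using finite_roots by (rule finite_subset)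
    have "x \<in> A" by (simp add: A_def)
    then show "A \<noteq> {}" by auto
    fix \<sigma> \<tau> assume "\<sigma> \<in> \<Lambda> - {0}" "\<tau> \<in> \<Lambda> - {0}" and nz: "bracket_const \<sigma> \<tau> \<noteq> 0"
    then have "\<sigma> + \<tau> \<noteq> 0"
      using bracket_const_opposite[of \<sigma>] by (auto simp: add_eq_0_iff)
    with nz show "\<sigma> + \<tau> \<in> \<Lambda> - {0}"
      using support[of \<sigma> \<tau>] support[of \<tau> \<sigma>]
      by (cases "d \<sigma> \<tau> = 0") (auto simp: bracket_const_def add.commute)
  next
    fix \<sigma> \<tau> \<nu> assume \<sigma>: "\<sigma> \<in> \<Lambda> - {0}" and \<tau>: "\<tau> \<in> \<Lambda> - {0}" and \<nu>: "\<nu> \<in> A"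
    show "a \<sigma> (\<tau> + \<nu>) * a \<tau> \<nu> - a \<tau> (\<sigma> + \<nu>) * a \<sigma> \<nu> = bracket_const \<sigma> \<tau> * a (\<sigma> + \<tau>) \<nu>"
    proof (cases "\<sigma> + (\<tau> + \<nu>) \<in> A")
      case True
      have mid: "a \<alpha> (\<beta> + \<nu>) * a \<beta> \<nu> = d \<alpha> (\<beta> + \<nu>) * d \<beta> \<nu>"
        if "\<alpha> \<in> \<Lambda> - {0}" "\<beta> \<in> \<Lambda> - {0}" "\<alpha> + (\<beta> + \<nu>) \<in> A" for \<alpha> \<beta>
        using convex[OF \<nu> that(3), of "\<beta> + \<nu>"] edge[of \<beta> \<nu>] edge[of \<alpha> "\<beta> + \<nu>"] that \<nu>
        by (auto simp: a_def)
      from True have True': "\<tau> + (\<sigma> + \<nu>) \<in> A" "\<sigma> + \<tau> + \<nu> \<in> A"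
        by (simp_all add: ac_simps)
      have "a (\<sigma> + \<tau>) \<nu> = d (\<sigma> + \<tau>) \<nu>"
        using True' \<nu> by (simp add: a_def)
      with mid[OF \<sigma> \<tau> True] mid[OF \<tau> \<sigma> True'(1)] left_rep[of \<sigma> \<tau> \<nu>] show ?thesis
        by (simp add: bracket_const_def)
    next
      case False
      then have "\<tau> + (\<sigma> + \<nu>) \<notin> A" "\<sigma> + \<tau> + \<nu> \<notin> A"
        by (simp_all add: ac_simps)
      with False show ?thesis by (auto simp: a_def)
    qed
  qed (use finite_roots bracket_const_jacobi in \<open>auto simp: bracket_const_def a_def split: if_splits\<close>)
  then obtain \<nu> where \<nu>: "\<nu> \<in> A" and none: "\<And>\<sigma>. \<sigma> \<in> \<Lambda> - {0} \<Longrightarrow> a \<sigma> \<nu> = 0"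
    by blast
  obtain \<beta> where \<beta>: "\<beta> \<in> A" "\<beta> \<noteq> \<nu>" "d (\<beta> - \<nu>) \<nu> \<noteq> 0"
    using successor[OF \<nu>] by (auto simp: nonloop_edges_def)
  then have "a (\<beta> - \<nu>) \<nu> \<noteq> 0" "\<beta> - \<nu> \<in> \<Lambda> - {0}"
    using \<nu> support[of "\<beta> - \<nu>" \<nu>] by (auto simp: a_def)
  with none show False by blast
qed

end

section \<open>From the algebra to its table\<close>

lemma cycle_in_trancl:
  assumes "\<And>i. i < m \<Longrightarrow> (v i, v (Suc i)) \<in> E" and "m > 0"
  shows "(v 0, v m) \<in> E\<^sup>+"
  using \<open>m > 0\<close> assms
proof (induction m rule: nat_induct_non_zero)
  case 1
  then show ?case by auto
next
  case (Suc n)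
  then show ?case by (auto intro: trancl_into_trancl)
qed

context left_symmetric_algebra
begin

lemma mul_zero_left [simp]: "mul 0 x = 0" and mul_zero_right [simp]: "mul x 0 = 0"
  using mul_scale_left[of 0 0 x] mul_scale_right[of x 0 0] by simp_all

lemma bracket_zero_right [simp]: "bracket x 0 = 0"
  by (simp add: bracket_def)

lemma mul_sum_right: "mul x (sum f F) = (\<Sum>i\<in>F. mul x (f i))"
  by (induction F rule: infinite_finite_induct) (simp_all add: mul_add_right)

lemma eigenvectors_coeffs_zero:
  assumes "finite F" and "\<And>\<mu>. \<mu> \<in> F \<Longrightarrow> mul x (e \<mu>) = scale \<mu> (e \<mu>)"
    and "\<And>\<mu>. \<mu> \<in> F \<Longrightarrow> e \<mu> \<noteq> 0" and "(\<Sum>\<mu>\<in>F. scale (a \<mu>) (e \<mu>)) = 0"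
  shows "\<forall>\<mu>\<in>F. a \<mu> = 0"
  using assms
proof (induction F arbitrary: a rule: finite_induct)
  case empty
  then show ?case by simp
next
  case (insert \<nu> F)
  let ?s = "\<Sum>\<mu>\<in>F. scale (a \<mu>) (e \<mu>)"
  have s: "scale (a \<nu>) (e \<nu>) + ?s = 0"
    using insert.prems(3) insert.hyps by simp
  have "mul x (scale (a \<nu>) (e \<nu>) + ?s) = 0" "scale \<nu> (scale (a \<nu>) (e \<nu>) + ?s) = 0"
    using s by simp_all
  then have "scale (a \<nu> * \<nu>) (e \<nu>) + (\<Sum>\<mu>\<in>F. scale (a \<mu> * \<mu>) (e \<mu>)) = 0"
    and "scale (a \<nu> * \<nu>) (e \<nu>) + (\<Sum>\<mu>\<in>F. scale (a \<mu> * \<nu>) (e \<mu>)) = 0"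
    using insert.prems(1)
    by (simp_all add: mul_add_right mul_scale_right mul_sum_right scale_right_distrib
        scale_sum_right mult.commute)
  then have "(\<Sum>\<mu>\<in>F. scale (a \<mu> * \<mu>) (e \<mu>)) = (\<Sum>\<mu>\<in>F. scale (a \<mu> * \<nu>) (e \<mu>))"
    by (metis add_left_imp_eq)
  then have "(\<Sum>\<mu>\<in>F. scale (a \<mu> * (\<mu> - \<nu>)) (e \<mu>)) = 0"
    by (simp add: right_diff_distrib scale_left_diff_distrib sum_subtractf)
  then have "\<forall>\<mu>\<in>F. a \<mu> * (\<mu> - \<nu>) = 0"
    by (intro insert.IH) (use insert.prems in auto)
  then have F0: "\<forall>\<mu>\<in>F. a \<mu> = 0"
    using insert.hyps by auto
  with s insert.prems(2)[of \<nu>] show ?case by simp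
qed

lemma finite_eigenvalues:
  assumes eigen: "\<And>\<mu>. \<mu> \<in> M \<Longrightarrow> mul x (e \<mu>) = scale \<mu> (e \<mu>)"
    and nz: "\<And>\<mu>. \<mu> \<in> M \<Longrightarrow> e \<mu> \<noteq> 0"
  shows "finite M"
proof -
  have inj: "inj_on e M"
  proof (rule inj_onI)
    fix \<mu> \<nu> assume "\<mu> \<in> M" "\<nu> \<in> M" "e \<mu> = e \<nu>"
    then have "scale \<mu> (e \<mu>) = scale \<nu> (e \<mu>)"
      by (metis eigen)
    with nz \<open>\<mu> \<in> M\<close> show "\<mu> = \<nu>"
      unfolding scale_cancel_right by blast
  qed
  have "independent (e ` M)"
    unfolding dependent_explicit
  proof (clarify)
    fix t u v
    assume t: "finite t" "t \<subseteq> e ` M" and sum0: "(\<Sum>v\<in>t. scale (u v) v) = 0"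
      and v: "v \<in> t" "u v \<noteq> 0"
    obtain F where F: "F \<subseteq> M" "finite F" "t = e ` F"
      using finite_subset_image[OF t] by auto
    have "(\<Sum>\<mu>\<in>F. scale (u (e \<mu>)) (e \<mu>)) = 0"
      using sum0 F inj by (simp add: sum.reindex inj_on_subset)
    then have "\<forall>\<mu>\<in>F. u (e \<mu>) = 0"
      using F eigen nz by (intro eigenvectors_coeffs_zero[of F x e]) blast+
    with v F show False by auto
  qed
  moreover obtain B where "finite B" "span B = UNIV"
    using finite_dimensional by blast
  ultimately have "finite (e ` M)"
    using independent_span_bound[of B "e ` M"] by auto
  with inj show ?thesis by (rule finite_imageD[rotated])
qed

lemma dim_le_1_imp_multiple:
  assumes "dim V \<le> 1" and "x \<in> V" and "y \<in> V" and "x \<noteq> 0"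
  shows "\<exists>k. y = scale k x"
proof -
  obtain B where B: "B \<subseteq> V" "independent B" "V \<subseteq> span B" "card B = dim V"
    by (rule basis_exists)
  obtain C where "finite C" "span C = UNIV"
    using finite_dimensional by blast
  then have "finite B"
    using independent_span_bound[of C B] B by auto
  then have "card B = 0 \<or> card B = Suc 0"
    using B assms(1) by linarith
  then obtain z where "B \<subseteq> {z}"
    using \<open>finite B\<close> by (auto simp: card_1_singleton_iff)
  then have "V \<subseteq> span {z}"
    using B span_mono by blast
  with assms have "x \<in> span {z}" "y \<in> span {z}"
    by blast+
  then obtain r s where "x = scale r z" "y = scale s z"
    unfolding span_singleton by blast
  with \<open>x \<noteq> 0\<close> show ?thesis
    by (intro exI[of _ "s / r"]) auto
qed

lemma functional_on_zero: "functional_on h (\<lambda>_. 0)"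
  by (simp add: functional_on_def)

lemma lie_nilpotent_subset_root_subspace_zero:
  assumes "lie_nilpotent h"
  shows "h \<subseteq> root_subspace bracket h (\<lambda>_. 0)"
proof
  fix y assume y: "y \<in> h"
  obtain n where n: "lower_central h n = {0}"
    using assms by (auto simp: lie_nilpotent_def)
  have "((\<lambda>z. bracket x z - scale 0 z) ^^ k) y \<in> lower_central h k" if "x \<in> h" for x k
  proof (induction k)
    case (Suc k)
    with that show ?case by (auto intro!: span_base)
  qed (simp add: y)
  with n show "y \<in> root_subspace bracket h (\<lambda>_. 0)"
    by (fastforce simp: root_subspace_def)
qed

text \<open>A Cartan subalgebra of a nonzero algebra is nonzero, being its own normalizer, and it lies
  in the null component. The dimension bound makes the two coincide.\<close>

lemma null_component_subset_cartan:
  assumes cc: "canonical_cartan h" and dim: "dim (component h (\<lambda>_. 0)) \<le> 1"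
    and x: "x \<in> component h (\<lambda>_. 0)"
  shows "x \<in> h"
proof (cases "h = {0}")
  case True
  then have "lie_normalizer h = UNIV"
    by (simp add: lie_normalizer_def)
  with cc show ?thesis by (simp add: canonical_cartan_def cartan_subalgebra_def)
next
  case False
  have sub: "subspace h" and nil: "lie_nilpotent h"
    and eq: "component h (\<lambda>_. 0) = root_subspace bracket h (\<lambda>_. 0)"
    using cc functional_on_zero
    by (auto simp: canonical_cartan_def cartan_subalgebra_def lie_subalgebra_def)
  from False obtain y where y: "y \<in> h" "y \<noteq> 0"
    using subspace_0[OF sub] by blast
  then have "y \<in> component h (\<lambda>_. 0)"
    using lie_nilpotent_subset_root_subspace_zero[OF nil] eq by auto
  then obtain k where "x = scale k y"
    using dim_le_1_imp_multiple[OF dim _ x] y by auto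
  with y sub show ?thesis by (simp add: subspace_scale)
qed

text \<open>On \<open>e \<alpha>\<close> the operators \<open>L e\<^sub>0\<close> and \<open>ad e\<^sub>0\<close> act by scalars whose difference is the
  coefficient of \<open>mul (e \<alpha>) e\<^sub>0\<close>. The two decompositions have the same roots, so it vanishes.\<close>

lemma root_table_structure_constants:
  assumes cc: "canonical_cartan h" and dim: "dim (component h (\<lambda>_. 0)) \<le> 1"
    and e\<^sub>0: "e\<^sub>0 \<in> component h (\<lambda>_. 0)"
    and basis: "root_basis h e\<^sub>0 e" and const: "structure_constants h e\<^sub>0 e c"
  shows "root_table (root_values h e\<^sub>0)
    (\<lambda>\<alpha> \<beta>. if \<alpha> + \<beta> \<in> root_values h e\<^sub>0 then c \<alpha> \<beta> else 0)"
    (is "root_table ?\<Lambda> ?d")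
proof
  have e_nz: "e \<alpha> \<noteq> 0" and eigen: "mul e\<^sub>0 (e \<alpha>) = scale \<alpha> (e \<alpha>)" if "\<alpha> \<in> ?\<Lambda>" for \<alpha>
    using that basis unfolding root_basis_def root_values_def by blast+
  show "finite ?\<Lambda>"
    using eigen e_nz by (rule finite_eigenvalues)
  have e_out: "e \<alpha> = 0" if "\<alpha> \<notin> ?\<Lambda>" for \<alpha>
    using that basis by (simp add: root_basis_def)
  have e_zero: "e 0 = e\<^sub>0"
    using basis by (simp add: root_basis_def)
  have c_out: "c \<alpha> \<beta> = 0 \<and> c \<beta> \<alpha> = 0" if "\<alpha> \<notin> ?\<Lambda>" for \<alpha> \<beta>
    using that const by (simp add: structure_constants_def)
  have prod: "mul (e \<alpha>) (e \<beta>) = scale (?d \<alpha> \<beta>) (e (\<alpha> + \<beta>))" for \<alpha> \<beta>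
    using const e_out[of "\<alpha> + \<beta>"] by (simp add: structure_constants_def)
  show support: "\<alpha> \<in> ?\<Lambda> \<and> \<beta> \<in> ?\<Lambda> \<and> \<alpha> + \<beta> \<in> ?\<Lambda>" if "?d \<alpha> \<beta> \<noteq> 0" for \<alpha> \<beta>
    using that c_out[of \<alpha> \<beta>] c_out[of \<beta> \<alpha>] by (auto split: if_splits)
  show "?d 0 \<alpha> = \<alpha>" if "\<alpha> \<in> ?\<Lambda>" for \<alpha>
    using prod[of 0 \<alpha>] eigen[OF that] e_nz[OF that] that by (simp add: e_zero)
  show "?d \<alpha> 0 = 0" for \<alpha>
  proof (cases "\<alpha> \<in> ?\<Lambda>")
    case True
    then obtain \<theta> where \<theta>: "functional_on h \<theta>" "component h \<theta> \<noteq> {0}" "\<alpha> = \<theta> e\<^sub>0"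
      by (auto simp: root_values_def)
    then have "e \<alpha> \<in> component h \<theta>"
      using basis by (auto simp: root_basis_def)
    then have "e \<alpha> \<in> root_subspace bracket h \<theta>"
      using cc \<theta> by (auto simp: canonical_cartan_def)
    moreover have "e\<^sub>0 \<in> h"
      using cc dim e\<^sub>0 by (rule null_component_subset_cartan)
    ultimately obtain n where n: "((\<lambda>z. bracket e\<^sub>0 z - scale \<alpha> z) ^^ n) (e \<alpha>) = 0"
      using \<theta>(3) by (auto simp: root_subspace_def)
    have bracket: "bracket e\<^sub>0 (e \<alpha>) = scale (\<alpha> - c \<alpha> 0) (e \<alpha>)"
      using prod[of \<alpha> 0] eigen[OF True] True
      by (simp add: bracket_def e_zero scale_left_diff_distrib)
    have linear: "bracket e\<^sub>0 (scale r z) = scale r (bracket e\<^sub>0 z)" for r z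
      by (simp add: bracket_def mul_scale_left mul_scale_right scale_right_diff_distrib)
    have step: "bracket e\<^sub>0 (scale r (e \<alpha>)) - scale \<alpha> (scale r (e \<alpha>))
        = scale (r * (\<alpha> - c \<alpha> 0) - \<alpha> * r) (e \<alpha>)" for r
      unfolding linear bracket scale_scale by (rule scale_left_diff_distrib[symmetric])
    have "((\<lambda>z. bracket e\<^sub>0 z - scale \<alpha> z) ^^ k) (e \<alpha>) = scale ((- c \<alpha> 0) ^ k) (e \<alpha>)" for k
    proof (induction k)
      case (Suc k)
      have "(- c \<alpha> 0) ^ k * (\<alpha> - c \<alpha> 0) - \<alpha> * (- c \<alpha> 0) ^ k = (- c \<alpha> 0) ^ Suc k"
        by (simp add: algebra_simps)
      with Suc step show ?case by simp
    qed simp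
    with n e_nz[OF True] show ?thesis by simp
  qed (use c_out in auto)
  show "?d \<alpha> (\<beta> + \<gamma>) * ?d \<beta> \<gamma> - ?d \<beta> (\<alpha> + \<gamma>) * ?d \<alpha> \<gamma>
      = (?d \<alpha> \<beta> - ?d \<beta> \<alpha>) * ?d (\<alpha> + \<beta>) \<gamma>" for \<alpha> \<beta> \<gamma>
  proof (cases "\<alpha> + (\<beta> + \<gamma>) \<in> ?\<Lambda>")
    case True
    define d where "d = ?d"
    have prod': "mul (e \<alpha>) (e \<beta>) = scale (d \<alpha> \<beta>) (e (\<alpha> + \<beta>))" for \<alpha> \<beta>
      unfolding d_def by (rule prod)
    have associator: "mul (e \<alpha>) (mul (e \<beta>) (e \<gamma>)) - mul (mul (e \<alpha>) (e \<beta>)) (e \<gamma>)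
        = scale (d \<alpha> (\<beta> + \<gamma>) * d \<beta> \<gamma> - d \<alpha> \<beta> * d (\<alpha> + \<beta>) \<gamma>) (e (\<alpha> + (\<beta> + \<gamma>)))" for \<alpha> \<beta>
      by (simp add: prod' mul_scale_left mul_scale_right scale_left_diff_distrib
          add.assoc mult.commute)
    have "scale (d \<alpha> (\<beta> + \<gamma>) * d \<beta> \<gamma> - d \<alpha> \<beta> * d (\<alpha> + \<beta>) \<gamma>) (e (\<alpha> + (\<beta> + \<gamma>)))
        = scale (d \<beta> (\<alpha> + \<gamma>) * d \<alpha> \<gamma> - d \<beta> \<alpha> * d (\<alpha> + \<beta>) \<gamma>) (e (\<alpha> + (\<beta> + \<gamma>)))"
      using left_symmetric[of "e \<alpha>" "e \<beta>" "e \<gamma>"]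
      unfolding associator add.left_commute[of \<beta> \<alpha> \<gamma>] add.commute[of \<beta> \<alpha>] .
    then have "d \<alpha> (\<beta> + \<gamma>) * d \<beta> \<gamma> - d \<alpha> \<beta> * d (\<alpha> + \<beta>) \<gamma>
        = d \<beta> (\<alpha> + \<gamma>) * d \<alpha> \<gamma> - d \<beta> \<alpha> * d (\<alpha> + \<beta>) \<gamma>"
      unfolding scale_cancel_right using e_nz[OF True] by blast
    then have "d \<alpha> (\<beta> + \<gamma>) * d \<beta> \<gamma> - d \<beta> (\<alpha> + \<gamma>) * d \<alpha> \<gamma>
        = (d \<alpha> \<beta> - d \<beta> \<alpha>) * d (\<alpha> + \<beta>) \<gamma>"
      by (simp add: algebra_simps)
    then show ?thesis unfolding d_def .
  next
    case False
    moreover from False have "\<beta> + (\<alpha> + \<gamma>) \<notin> ?\<Lambda>" "\<alpha> + \<beta> + \<gamma> \<notin> ?\<Lambda>"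
      by (simp_all add: ac_simps)
    ultimately show ?thesis by simp
  qed
qed

end

theorem mainTheorem6:
  fixes scale :: "complex \<Rightarrow> 'a::ab_group_add \<Rightarrow> 'a"
    and mul :: "'a \<Rightarrow> 'a \<Rightarrow> 'a"
    and h :: "'a set"
    and e\<^sub>0 :: 'a
    and e :: "complex \<Rightarrow> 'a"
    and c :: "complex \<Rightarrow> complex \<Rightarrow> complex"
  assumes "left_symmetric_algebra scale mul"
    and "(UNIV :: 'a set) \<noteq> {0}"
    and "left_symmetric_algebra.complete_lsa scale mul"
    and "left_symmetric_algebra.canonical_cartan scale mul h"
    and "\<And>\<theta>. left_symmetric_algebra.functional_on scale h \<theta> \<Longrightarrow>
           vector_space.dim scale (left_symmetric_algebra.root_subspace scale mul h \<theta>) \<le> 1"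
    and "e\<^sub>0 \<in> left_symmetric_algebra.root_subspace scale mul h (\<lambda>_. 0)"
    and "e\<^sub>0 \<noteq> 0"
    and "left_symmetric_algebra.root_basis scale mul h e\<^sub>0 e"
    and "left_symmetric_algebra.structure_constants scale mul h e\<^sub>0 e c"
  shows "\<not> (\<exists>(m::nat) (v :: nat \<Rightarrow> complex). m \<ge> 2 \<and> inj_on v {..<m} \<and> v m = v 0 \<and>
           (\<forall>i<m. (v i, v (Suc i)) \<in> left_symmetric_algebra.left_graph scale mul h e\<^sub>0 c))"
proof
  interpret A: left_symmetric_algebra scale mul by fact
  let ?\<Lambda> = "A.root_values h e\<^sub>0"
  interpret T: root_table ?\<Lambda> "\<lambda>\<alpha> \<beta>. if \<alpha> + \<beta> \<in> ?\<Lambda> then c \<alpha> \<beta> else 0"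
    using assms(4) assms(5)[OF A.functional_on_zero] assms(6,8,9)
    by (rule A.root_table_structure_constants)
  assume "\<exists>(m::nat) (v :: nat \<Rightarrow> complex). m \<ge> 2 \<and> inj_on v {..<m} \<and> v m = v 0 \<and>
    (\<forall>i<m. (v i, v (Suc i)) \<in> A.left_graph h e\<^sub>0 c)"
  then obtain m v where m: "m \<ge> 2" and inj: "inj_on v {..<m}" and closed: "v m = v 0"
    and edges: "\<And>i. i < m \<Longrightarrow> (v i, v (Suc i)) \<in> A.left_graph h e\<^sub>0 c"
    by blast
  have "(v i, v (Suc i)) \<in> T.nonloop_edges" if "i < m" for i
  proof -
    have "v i \<noteq> v (Suc i)"
    proof (cases "Suc i = m")
      case True
      with inj_onD[OF inj, of i 0] closed m that show ?thesis by auto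
    next
      case False
      with inj_onD[OF inj, of i "Suc i"] that show ?thesis by auto
    qed
    with edges[OF that] show ?thesis
      by (simp add: T.nonloop_edges_def A.left_graph_def)
  qed
  then have "(v 0, v m) \<in> T.nonloop_edges\<^sup>+"
    by (rule cycle_in_trancl) (use m in auto)
  with closed T.acyclic_nonloop_edges show False
    by (simp add: acyclic_def)
qed

end
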